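(* Let $X$ be a complete, quasiconvex metric space, let $Y \subset X$, and let $d \geq 1$ be a real number. Assume that there is some $\epsilon_0 > 0$ such that \[ \sum_{k \geq 0} N(Y,\epsilon_0 2^{-k})\,2^{-kd} < \infty . \] Then $Y$ can be covered by a $\frac{1}{d}$-Hölder curve in $X$, i.e. there is a $\frac1d$-Hölder map $f : [0,1] \to X$ with $Y \subset f([0,1])$.
   Context: Metric spaces are nonempty. A metric space $(X,d_X)$ is called quasiconvex if there is a constant $C_X \geq 1$ such that any two points $x,y \in X$ can be connected by a path $\gamma : [0,1] \to X$ of length $\ell(\gamma) \leq C_X d_X(x,y)$. For a set $S$ in a metric space and $\epsilon > 0$, $N(S,\epsilon)$ denotes the minimal number of balls of radius $\epsilon$ needed to cover $S$ ($N(S,\epsilon) = \infty$ if no finite cover exists). For $0 < \alpha \leq 1$, a map $f : [0,1] \to X$ is $\alpha$-Hölder if there is a constant $L \geq 0$ with $d_X(f(s),f(t)) \leq L|s-t|^\alpha$ for all $s,t \in [0,1]$. Such a map is called an $\alpha$-Hölder curve in $X$. *)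

theory Defs
  imports "HOL-Analysis.Analysis"
begin

text \<open>The length of a map on the unit interval, as the supremum over all subdivisions
  \<open>0 = t 0 \<le> \<dots> \<le> t n = 1\<close>; it is infinite for non-rectifiable maps.\<close>

definition curve_length :: "(real \<Rightarrow> 'a::metric_space) \<Rightarrow> ennreal" where
  "curve_length \<gamma> =
     (SUP (n, t) \<in> {(n::nat, t::nat \<Rightarrow> real). t 0 = 0 \<and> t n = 1 \<and> mono_on {..n} t}.
        \<Sum>i<n. ennreal (dist (\<gamma> (t i)) (\<gamma> (t (Suc i)))))"

definition quasiconvex :: "'a::metric_space set \<Rightarrow> bool" where
  "quasiconvex X \<longleftrightarrow>
     (\<exists>C\<ge>1. \<forall>x\<in>X. \<forall>y\<in>X. \<exists>\<gamma>. path \<gamma> \<and> path_image \<gamma> \<subseteq> X \<and>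
        pathstart \<gamma> = x \<and> pathfinish \<gamma> = y \<and> curve_length \<gamma> \<le> ennreal (C * dist x y))"

text \<open>Balls are open and centred anywhere in the ambient space. Counting centres instead of
  balls does not change the minimum. If there is no finite cover, the infimum is over the
  empty set and equals \<open>\<infinity>\<close>.\<close>

definition covering_number :: "'a::metric_space set \<Rightarrow> real \<Rightarrow> enat" where
  "covering_number S \<epsilon> =
     (INF A \<in> {A. finite A \<and> S \<subseteq> (\<Union>a\<in>A. ball a \<epsilon>)}. enat (card A))"

text \<open>Only the values of \<open>f\<close> on the unit interval matter.\<close>

definition holder_curve :: "real \<Rightarrow> (real \<Rightarrow> 'a::metric_space) \<Rightarrow> bool" where
  "holder_curve \<alpha> f \<longleftrightarrow> 0 < \<alpha> \<and> \<alpha> \<le> 1 \<and>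
     (\<exists>L\<ge>0. \<forall>s\<in>{0..1}. \<forall>t\<in>{0..1}. dist (f s) (f t) \<le> L * \<bar>s - t\<bar> powr \<alpha>)"

end

theory Submission
  imports Defs
begin

text \<open>
  For each scale \<open>\<epsilon>\<^sub>0 2\<^sup>-\<^sup>n\<close> take a finite set \<open>A n\<close> of centres of balls that cover \<open>Y\<close>, all of them
  meeting \<open>Y\<close>. A point of \<open>A (n + 1)\<close> and some point of \<open>A n\<close> then lie in balls with a common point
  of \<open>Y\<close>, so their distance is of order \<open>2\<^sup>-\<^sup>n\<close>; joining every point to such a parent turns the
  union of the \<open>A n\<close> into a tree. The curve is a traversal of this tree in which every edge
  leading to a point of \<open>A n\<close> is given the time \<open>2\<^sup>-\<^sup>n\<^sup>d\<close> in each direction. For covers of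
  minimal cardinality the hypothesis on \<open>Y\<close> bounds the total time.

  Two estimates make the limit Hoelder. By quasiconvexity an edge of length of order \<open>2\<^sup>-\<^sup>n\<close> can be
  run through at constant speed of order \<open>2\<^sup>-\<^sup>n / 2\<^sup>-\<^sup>n\<^sup>d = 2\<^sup>n\<^sup>(\<^sup>d\<^sup>-\<^sup>1\<^sup>)\<close>, which does not
  decrease with \<open>n\<close> because \<open>d \<ge> 1\<close>; so the traversal \<open>F n\<close> of the first \<open>n\<close> levels is Lipschitz with a constant of that order.
  The levels from \<open>n\<close> on move the curve by a distance of order \<open>2\<^sup>-\<^sup>n\<close> only. For \<open>\<bar>s - t\<bar>\<close> of order
  \<open>2\<^sup>-\<^sup>n\<^sup>d\<close> both contributions to \<open>dist (f s) (f t)\<close> are therefore of order \<open>2\<^sup>-\<^sup>n\<close>, that is, of order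
  \<open>\<bar>s - t\<bar>\<close> to the power \<open>1 / d\<close> (\<open>holder_curve_of_lipschitz_approximations\<close>). Since the image of
  the limit is compact and comes arbitrarily close to every point of \<open>Y\<close>, it contains \<open>Y\<close>.

  The tree is never formed. Instead, \<open>F (n + 1)\<close> arises from \<open>F n\<close> by stopping the clock at finitely
  many times and making a round trip to a new point there (\<open>insert_excursions\<close>). All curves are
  defined on the whole real line. Because an insertion shifts all later times, \<open>F (n + 1)\<close> is close
  not to \<open>F n\<close> but to \<open>F n \<circ> \<pi> n\<close>, where \<open>\<pi> n\<close> collapses the inserted time intervals. The maps \<open>\<pi> n\<close>
  are 1-Lipschitz and move points by a summable amount, so they have an inverse limit
  (\<open>inverse_limit_of_collapses\<close>): 1-Lipschitz maps \<open>P n\<close> with \<open>P n = \<pi> n \<circ> P (n + 1)\<close>. The curves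
  \<open>F n \<circ> P n\<close> share one time parameter and converge uniformly
  (\<open>holder_curve_limit_of_tower\<close>).

  Constant speed along a path of finite length is the content of \<open>lipschitz_reparametrization\<close>.
\<close>

section \<open>Lipschitz parametrization of rectifiable paths\<close>

text \<open>The curve \<open>\<lambda>u. \<gamma> (min u s)\<close> is \<open>\<gamma>\<close> stopped at time \<open>s\<close>, so its length is the arc length of \<open>\<gamma>\<close> up
to \<open>s\<close>; in this form it refers to subdivisions of the fixed interval from 0 to 1. Truncating a
subdivision at \<open>s\<close> and appending the point 1 leaves the sum for the curve stopped at \<open>s\<close> unchanged
except for the additional jump from \<open>\<gamma> s\<close> to \<open>\<gamma> t\<close>.\<close>

lemma curve_length_stopped_add_dist_le:
  assumes "0 \<le> s" "s \<le> t" "t \<le> 1"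
  shows "curve_length (\<lambda>u. \<gamma> (min u s)) + ennreal (dist (\<gamma> s) (\<gamma> t))
           \<le> curve_length (\<lambda>u. \<gamma> (min u t))"
proof -
  define I where "I = {(n::nat, p::nat \<Rightarrow> real). p 0 = 0 \<and> p n = 1 \<and> mono_on {..n} p}"
  define S where "S = (\<lambda>r (n, p). \<Sum>i<n. ennreal (dist (\<gamma> (min (p i) r)) (\<gamma> (min (p (Suc i)) r))))"
  have len: "curve_length (\<lambda>u. \<gamma> (min u r)) = (SUP x\<in>I. S r x)" for r
    unfolding curve_length_def I_def S_def by simp
  have "(1, \<lambda>i. if i = 0 then 0 else 1) \<in> I"
    by (auto simp: I_def mono_on_def)
  then have "I \<noteq> {}" by blast
  then have "curve_length (\<lambda>u. \<gamma> (min u s)) + ennreal (dist (\<gamma> s) (\<gamma> t))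
      = (SUP x\<in>I. S s x + ennreal (dist (\<gamma> s) (\<gamma> t)))"
    unfolding len by (rule ennreal_SUP_add_left[symmetric])
  also have "\<dots> \<le> (SUP x\<in>I. S t x)"
  proof (rule SUP_least)
    fix x assume "x \<in> I"
    then obtain n p where x: "x = (n, p)" and p: "p 0 = 0" "p n = 1" "mono_on {..n} p"
      by (auto simp: I_def)
    define q where "q = (\<lambda>i. if i \<le> n then min (p i) s else 1)"
    have "mono_on {..Suc n} q"
      using assms p(3) by (auto simp: q_def mono_on_def min_def intro: order_trans)
    then have "(Suc n, q) \<in> I"
      using p assms by (auto simp: I_def q_def)
    moreover have "S t (Suc n, q) = S s x + ennreal (dist (\<gamma> s) (\<gamma> t))"
    proof -
      have "min (q i) t = min (p i) s" if "i \<le> n" for i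
        using assms that by (simp add: q_def)
      moreover have "min (q (Suc n)) t = t"
        using assms by (simp add: q_def)
      moreover have "min (q n) t = s"
        using assms p(2) by (simp add: q_def)
      ultimately show ?thesis by (simp add: S_def x del: sum_ennreal)
    qed
    ultimately show "S s x + ennreal (dist (\<gamma> s) (\<gamma> t)) \<le> (SUP x\<in>I. S t x)"
      by (metis SUP_upper)
  qed
  finally show ?thesis by (simp add: len)
qed

lemma curve_length_stopped_1: "curve_length (\<lambda>u. \<gamma> (min u 1)) = curve_length \<gamma>"
  unfolding curve_length_def
proof (rule SUP_cong[OF refl], clarify)
  fix n and p :: "nat \<Rightarrow> real"
  assume p: "p 0 = 0" "p n = 1" "mono_on {..n} p"
  have "p i \<le> 1" if "i \<le> n" for i
    using p(2) mono_onD[OF p(3), of i n] that by simp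
  then show "(\<Sum>i<n. ennreal (dist (\<gamma> (min (p i) 1)) (\<gamma> (min (p (Suc i)) 1))))
      = (\<Sum>i<n. ennreal (dist (\<gamma> (p i)) (\<gamma> (p (Suc i)))))"
    by (intro sum.cong) (auto simp: min_def)
qed

text \<open>With \<open>l\<close> the arc length, \<open>h u = \<gamma> (\<tau> u)\<close> where \<open>\<tau> u\<close> is the supremum of the times at which the arc
length is at most \<open>\<Lambda> u\<close>. This bypasses the continuity of \<open>l\<close>. Indeed, for times \<open>s < t\<close>
strictly between \<open>\<tau> u\<close> and \<open>\<tau> v\<close> the arc length is above \<open>\<Lambda> u\<close> at \<open>s\<close> and at most \<open>\<Lambda> v\<close> at \<open>t\<close>, so
\<open>dist (\<gamma> s) (\<gamma> t) \<le> \<Lambda> (v - u)\<close>, and the continuity of \<open>\<gamma>\<close> carries this bound to the end points.\<close>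

lemma lipschitz_reparametrization:
  fixes \<gamma> :: "real \<Rightarrow> 'a::metric_space"
  assumes "path \<gamma>" and len: "curve_length \<gamma> \<le> ennreal \<Lambda>" and "\<Lambda> \<ge> 0"
  obtains h :: "real \<Rightarrow> 'a"
    where "\<Lambda>-lipschitz_on {0..1} h" "h 0 = pathstart \<gamma>" "h 1 = pathfinish \<gamma>"
proof -
  have cont: "continuous_on {0..1} \<gamma>"
    using \<open>path \<gamma>\<close> by (simp add: path_def)
  define E where "E = (\<lambda>s. curve_length (\<lambda>u. \<gamma> (min u s)))"
  define l where "l = (\<lambda>s. enn2real (E s))"
  have E: "E s + ennreal (dist (\<gamma> s) (\<gamma> t)) \<le> E t" if "0 \<le> s" "s \<le> t" "t \<le> 1" for s t
    unfolding E_def using that by (rule curve_length_stopped_add_dist_le)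
  have E1: "E 1 \<le> ennreal \<Lambda>"
    using len by (simp add: E_def curve_length_stopped_1)
  have El: "E s = ennreal (l s)" if "0 \<le> s" "s \<le> 1" for s
  proof -
    have "E s \<le> E 1"
      by (rule order_trans[OF _ E[of s 1]]) (use that in simp_all)
    also have "\<dots> < top"
      using E1 by (simp add: le_less_trans)
    finally show ?thesis by (simp add: l_def)
  qed
  have l0: "0 \<le> l s" for s by (simp add: l_def)
  have l: "dist (\<gamma> s) (\<gamma> t) \<le> l t - l s" if "0 \<le> s" "s \<le> t" "t \<le> 1" for s t
  proof -
    have "ennreal (l s + dist (\<gamma> s) (\<gamma> t)) \<le> ennreal (l t)"
      using E[OF that] that by (simp add: El l0 ennreal_plus)
    then have "l s + dist (\<gamma> s) (\<gamma> t) \<le> l t"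
      by (rule iffD1[OF ennreal_le_iff[OF l0]])
    then show ?thesis by simp
  qed
  have l01: "l 1 - l 0 \<le> \<Lambda>"
  proof -
    have "l 1 \<le> \<Lambda>" using E1 \<open>\<Lambda> \<ge> 0\<close> El[of 1] by simp
    moreover have "l 0 \<ge> 0" by (simp add: l_def)
    ultimately show ?thesis by simp
  qed
  have mono: "l s \<le> l t" if "0 \<le> s" "s \<le> t" "t \<le> 1" for s t
    using l[OF that] zero_le_dist[of "\<gamma> s" "\<gamma> t"] by linarith
  define T where "T = (\<lambda>u. {t\<in>{0..1}. l t \<le> l 0 + \<Lambda> * u})"
  define \<tau> where "\<tau> = (\<lambda>u. Sup (T u))"
  have T: "0 \<in> T u" "bdd_above (T u)" if "u \<in> {0..1}" for u
    using that \<open>\<Lambda> \<ge> 0\<close> by (auto simp: T_def intro!: bdd_aboveI[of _ 1])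
  have below: "t \<in> T u" if "u \<in> {0..1}" "0 \<le> t" "t < \<tau> u" for u t
  proof -
    obtain t' where "t' \<in> T u" "t < t'"
      using less_cSupE[of t "T u"] T(1)[OF \<open>u \<in> {0..1}\<close>] \<open>t < \<tau> u\<close> unfolding \<tau>_def by blast
    then show ?thesis using mono[of t t'] that by (auto simp: T_def)
  qed
  have above: "t \<notin> T u" if "u \<in> {0..1}" "\<tau> u < t" for u t
    using that cSup_upper[of t "T u"] T[of u] by (auto simp: \<tau>_def)
  have \<tau>: "\<tau> u \<in> {0..1}" if "u \<in> {0..1}" for u
  proof -
    have "0 \<le> \<tau> u" unfolding \<tau>_def using T[OF that] by (rule cSup_upper)
    moreover have "\<tau> u \<le> 1"
      unfolding \<tau>_def using T(1)[OF that] by (intro cSup_least, blast) (simp add: T_def)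
    ultimately show ?thesis by simp
  qed
  have lip: "dist (\<gamma> (\<tau> u)) (\<gamma> (\<tau> v)) \<le> \<Lambda> * (v - u)" if uv: "u \<in> {0..1}" "v \<in> {0..1}" "u \<le> v" for u v
  proof (cases "\<tau> u < \<tau> v")
    case True
    define a b where "a = \<tau> u" and "b = \<tau> v"
    have ab: "a < b" "0 \<le> a" "b \<le> 1"
      using True \<tau>[OF uv(1)] \<tau>[OF uv(2)] by (auto simp: a_def b_def)
    have *: "dist (\<gamma> s) (\<gamma> t) \<le> \<Lambda> * (v - u)" if "a < s" "s < t" "t < b" for s t
    proof -
      have "l t \<le> l 0 + \<Lambda> * v"
        using below[OF uv(2), of t] that ab by (auto simp: b_def T_def)
      moreover have "l s > l 0 + \<Lambda> * u"
        using above[OF uv(1), of s] that ab by (auto simp: a_def T_def)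
      ultimately show ?thesis
        using l[of s t] that ab by (auto simp: algebra_simps)
    qed
    \<comment> \<open>The two arguments are moved to the end points one after the other.\<close>
    have **: "dist (\<gamma> s) (\<gamma> b) \<le> \<Lambda> * (v - u)" if "a < s" "s < b" for s
    proof (rule continuous_le_on_closure[where S = "{s<..<b}" and f = "\<lambda>t. dist (\<gamma> s) (\<gamma> t)"])
      show "continuous_on (closure {s<..<b}) (\<lambda>t. dist (\<gamma> s) (\<gamma> t))"
        using that ab by (auto intro!: continuous_intros continuous_on_subset[OF cont])
      show "b \<in> closure {s<..<b}" using that by auto
    qed (use * that in auto)
    have "dist (\<gamma> a) (\<gamma> b) \<le> \<Lambda> * (v - u)"
    proof (rule continuous_le_on_closure[where S = "{a<..<b}" and f = "\<lambda>t. dist (\<gamma> t) (\<gamma> b)"])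
      show "continuous_on (closure {a<..<b}) (\<lambda>t. dist (\<gamma> t) (\<gamma> b))"
        using ab by (auto intro!: continuous_intros continuous_on_subset[OF cont])
      show "a \<in> closure {a<..<b}" using ab by auto
    qed (use ** in auto)
    then show ?thesis by (simp add: a_def b_def)
  next
    case False
    have "T u \<subseteq> T v"
      using uv \<open>\<Lambda> \<ge> 0\<close> mult_left_mono[of u v \<Lambda>] by (auto simp: T_def)
    then have "\<tau> u \<le> \<tau> v"
      unfolding \<tau>_def using T(1)[OF uv(1)] T(2)[OF uv(2)] by (intro cSup_subset_mono) blast+
    with False show ?thesis using uv \<open>\<Lambda> \<ge> 0\<close> by simp
  qed
  show thesis
  proof
    show "\<Lambda>-lipschitz_on {0..1} (\<lambda>u. \<gamma> (\<tau> u))"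
    proof (rule lipschitz_on_leI[OF _ \<open>\<Lambda> \<ge> 0\<close>])
      fix u v :: real assume "u \<in> {0..1}" "v \<in> {0..1}" "u \<le> v"
      then show "dist (\<gamma> (\<tau> u)) (\<gamma> (\<tau> v)) \<le> \<Lambda> * dist u v"
        using lip[of u v] by (simp add: dist_real_def)
    qed
    \<comment> \<open>\<open>\<gamma>\<close> may rest at its starting point for a while; then \<open>\<tau> 0\<close> is the end of that rest.\<close>
    have "dist (\<gamma> 0) (\<gamma> (\<tau> 0)) \<le> 0"
    proof (cases "\<tau> 0 = 0")
      case False
      then have pos: "0 < \<tau> 0" "\<tau> 0 \<le> 1" using \<tau>[of 0] by auto
      show ?thesis
      proof (rule continuous_le_on_closure[where S = "{0<..<\<tau> 0}" and f = "\<lambda>t. dist (\<gamma> 0) (\<gamma> t)"])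
        show "continuous_on (closure {0<..<\<tau> 0}) (\<lambda>t. dist (\<gamma> 0) (\<gamma> t))"
          using pos by (auto intro!: continuous_intros continuous_on_subset[OF cont])
        show "\<tau> 0 \<in> closure {0<..<\<tau> 0}" using pos by auto
        show "dist (\<gamma> 0) (\<gamma> t) \<le> 0" if "t \<in> {0<..<\<tau> 0}" for t
        proof -
          have "l t \<le> l 0"
            using below[of 0 t] that by (simp add: T_def)
          moreover have "dist (\<gamma> 0) (\<gamma> t) \<le> l t - l 0"
            using that pos by (intro l) auto
          ultimately show ?thesis by linarith
        qed
      qed
    qed simp
    then show "\<gamma> (\<tau> 0) = pathstart \<gamma>" by (simp add: pathstart_def)
    have "\<tau> 1 = 1"
      unfolding \<tau>_def using l01 by (intro cSup_eq_maximum) (auto simp: T_def)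
    then show "\<gamma> (\<tau> 1) = pathfinish \<gamma>" by (simp add: pathfinish_def)
  qed
qed

lemma quasiconvex_imp_lipschitz_connected:
  assumes "quasiconvex (UNIV :: 'a::metric_space set)"
  obtains C where "C \<ge> 1"
    "\<And>x y::'a. \<exists>h::real \<Rightarrow> 'a. (C * dist x y)-lipschitz_on {0..1} h \<and> h 0 = x \<and> h 1 = y"
proof -
  obtain C where C: "C \<ge> 1" and path: "\<And>x y::'a. \<exists>\<gamma>. path \<gamma> \<and>
      pathstart \<gamma> = x \<and> pathfinish \<gamma> = y \<and> curve_length \<gamma> \<le> ennreal (C * dist x y)"
    using assms unfolding quasiconvex_def by blast
  have "\<exists>h::real \<Rightarrow> 'a. (C * dist x y)-lipschitz_on {0..1} h \<and> h 0 = x \<and> h 1 = y" for x y :: 'a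
  proof -
    obtain \<gamma> where \<gamma>: "path \<gamma>" "pathstart \<gamma> = x" "pathfinish \<gamma> = y"
      "curve_length \<gamma> \<le> ennreal (C * dist x y)"
      using path by blast
    have "0 \<le> C * dist x y" using C by simp
    then obtain h :: "real \<Rightarrow> 'a" where "(C * dist x y)-lipschitz_on {0..1} h"
      "h 0 = pathstart \<gamma>" "h 1 = pathfinish \<gamma>"
      by (rule lipschitz_reparametrization[OF \<gamma>(1,4)])
    with \<gamma>(2,3) show ?thesis by (intro exI[of _ h] conjI) simp_all
  qed
  with C that show thesis by blast
qed

section \<open>Inserting excursions into a curve\<close>

lemma lipschitz_on_glue:
  fixes f :: "real \<Rightarrow> 'a::metric_space"
  assumes l: "K-lipschitz_on (A \<inter> {..c}) f" and r: "K-lipschitz_on (A \<inter> {c..}) f" and "c \<in> A"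
  shows "K-lipschitz_on A f"
proof (rule lipschitz_on_leI)
  fix x y assume xy: "x \<in> A" "y \<in> A" "x \<le> y"
  consider "y \<le> c" | "c \<le> x" | "x \<le> c" "c \<le> y" by linarith
  then show "dist (f x) (f y) \<le> K * dist x y"
  proof cases
    case 3
    have "dist (f x) (f y) \<le> dist (f x) (f c) + dist (f c) (f y)" by (rule dist_triangle)
    also have "\<dots> \<le> K * dist x c + K * dist c y"
      using 3 xy \<open>c \<in> A\<close> by (intro add_mono lipschitz_onD[OF l] lipschitz_onD[OF r]) auto
    also have "\<dots> = K * dist x y"
      using 3 by (simp add: dist_real_def algebra_simps)
    finally show ?thesis .
  qed (use xy lipschitz_onD[OF l, of x y] lipschitz_onD[OF r, of x y] in auto)
qed (use lipschitz_on_nonneg[OF l] in auto)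

text \<open>At time \<open>t\<close> the curve \<open>f\<close> is interrupted for the time \<open>2 * \<tau>\<close>, during which \<open>h\<close> is run through forth
and back; \<open>\<pi>\<close> contracts the inserted interval to \<open>t\<close>. Each of the two
passages takes the time \<open>\<tau>\<close>, so \<open>h\<close> may have the Lipschitz constant \<open>K * \<tau>\<close> on its unit interval. The last property says that no value of
\<open>f\<close> is lost: it makes it possible to insert several excursions one after the other.\<close>

lemma insert_excursion:
  fixes f h :: "real \<Rightarrow> 'a::metric_space"
  assumes f: "K-lipschitz_on UNIV f" and "\<tau> > 0"
    and h: "(K * \<tau>)-lipschitz_on {0..1} h" and h0: "h 0 = f t"
  obtains g \<pi> where "K-lipschitz_on UNIV g" "1-lipschitz_on UNIV \<pi>"
    "\<And>s. 0 \<le> s - \<pi> s" "\<And>s. s - \<pi> s \<le> 2 * \<tau>"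
    "\<And>s. g s = f (\<pi> s) \<or> \<pi> s = t \<and> g s \<in> h ` {0..1}"
    "g (t + \<tau>) = h 1" "\<And>u. \<exists>s. \<pi> s = u \<and> g s = f u"
proof
  \<comment> \<open>\<open>\<pi> s\<close> is \<open>s\<close> before the excursion, \<open>t\<close> during it and \<open>s - 2 * \<tau>\<close> after it.\<close>
  define \<pi> where "\<pi> = (\<lambda>s. min s (max t (s - 2 * \<tau>)))"
  define e where "e = (\<lambda>s. h (1 - \<bar>s - (t + \<tau>)\<bar> / \<tau>))"
  define g where "g = (\<lambda>s. if s < t \<or> t + 2 * \<tau> < s then f (\<pi> s) else e s)"
  have K: "0 \<le> K" using f by (rule lipschitz_on_nonneg)
  have range: "1 - \<bar>s - (t + \<tau>)\<bar> / \<tau> \<in> {0..1}" if "t \<le> s" "s \<le> t + 2 * \<tau>" for s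
    using that \<open>\<tau> > 0\<close> by (auto simp: field_simps)
  have e: "K-lipschitz_on {t..t + 2 * \<tau>} e"
  proof (rule lipschitz_onI[OF _ K])
    fix x y assume xy: "x \<in> {t..t + 2 * \<tau>}" "y \<in> {t..t + 2 * \<tau>}"
    have "dist (e x) (e y) \<le> K * \<tau> * dist (1 - \<bar>x - (t + \<tau>)\<bar> / \<tau>) (1 - \<bar>y - (t + \<tau>)\<bar> / \<tau>)"
      unfolding e_def using xy by (intro lipschitz_onD[OF h] range) auto
    also have "\<dots> = K * \<bar>\<bar>y - (t + \<tau>)\<bar> - \<bar>x - (t + \<tau>)\<bar>\<bar>"
      using \<open>\<tau> > 0\<close> by (simp add: dist_real_def abs_mult abs_divide flip: diff_divide_distrib)
    also have "\<dots> \<le> K * dist x y"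
      by (rule mult_left_mono[OF _ K]) (auto simp: dist_real_def)
    finally show "dist (e x) (e y) \<le> K * dist x y" .
  qed
  have ends: "e t = f t" "e (t + 2 * \<tau>) = f t"
    using \<open>\<tau> > 0\<close> h0 by (auto simp: e_def)
  have left: "g s = f s" if "s \<le> t" for s
    using that ends \<open>\<tau> > 0\<close> by (auto simp: g_def \<pi>_def min_def max_def)
  have mid: "g s = e s" if "s \<in> {t..t + 2 * \<tau>}" for s
    using that by (auto simp: g_def)
  have right: "g s = f (s - 2 * \<tau>)" if "t + 2 * \<tau> \<le> s" for s
    using that ends \<open>\<tau> > 0\<close> by (cases "s = t + 2 * \<tau>") (auto simp: g_def \<pi>_def min_def max_def)
  show "K-lipschitz_on UNIV g"
  proof (rule lipschitz_on_glue[of _ _ "t + 2 * \<tau>"])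
    show "K-lipschitz_on (UNIV \<inter> {..t + 2 * \<tau>}) g"
    proof (rule lipschitz_on_glue[of _ _ t])
      show "K-lipschitz_on (UNIV \<inter> {..t + 2 * \<tau>} \<inter> {..t}) g"
        using lipschitz_onD[OF f] K by (intro lipschitz_onI) (auto simp: left)
      show "K-lipschitz_on (UNIV \<inter> {..t + 2 * \<tau>} \<inter> {t..}) g"
        using lipschitz_onD[OF e] K by (intro lipschitz_onI) (auto simp: mid)
    qed (use \<open>\<tau> > 0\<close> in auto)
    show "K-lipschitz_on (UNIV \<inter> {t + 2 * \<tau>..}) g"
    proof (rule lipschitz_onI[OF _ K])
      fix x y assume "x \<in> UNIV \<inter> {t + 2 * \<tau>..}" "y \<in> UNIV \<inter> {t + 2 * \<tau>..}"
      then show "dist (g x) (g y) \<le> K * dist x y"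
        using lipschitz_onD[OF f, of "x - 2 * \<tau>" "y - 2 * \<tau>"] by (auto simp: right dist_real_def)
    qed
  qed auto
  show "1-lipschitz_on UNIV \<pi>"
    by (rule lipschitz_onI) (auto simp: \<pi>_def dist_real_def min_def max_def)
  show "0 \<le> s - \<pi> s" "s - \<pi> s \<le> 2 * \<tau>" for s
    using \<open>\<tau> > 0\<close> by (auto simp: \<pi>_def min_def max_def)
  show "g s = f (\<pi> s) \<or> \<pi> s = t \<and> g s \<in> h ` {0..1}" for s
    using range[of s] by (auto simp: g_def e_def \<pi>_def min_def max_def)
  show "g (t + \<tau>) = h 1"
    using \<open>\<tau> > 0\<close> by (simp add: mid e_def)
  show "\<exists>s. \<pi> s = u \<and> g s = f u" for u
  proof (cases "u \<le> t")
    case True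
    then show ?thesis using left[of u] \<open>\<tau> > 0\<close> by (intro exI[of _ u]) (auto simp: \<pi>_def)
  next
    case False
    then show ?thesis using right[of "u + 2 * \<tau>"] \<open>\<tau> > 0\<close>
      by (intro exI[of _ "u + 2 * \<tau>"]) (auto simp: \<pi>_def)
  qed
qed

text \<open>Every \<open>a \<in> A\<close> is visited from a point of the original curve \<open>f\<close>, not from a point of an earlier
excursion. This is why the distance to \<open>f\<close> stays bounded by \<open>C * \<delta>\<close> regardless of the number of
points, and it is what the last property provides: the value \<open>f t\<close> from which \<open>a\<close> is to be
visited is still attained, at a time that the collapse maps to \<open>t\<close>.\<close>

lemma insert_excursions:
  fixes f :: "real \<Rightarrow> 'a::metric_space"
  assumes C: "\<And>x y::'a. \<exists>h::real \<Rightarrow> 'a. (C * dist x y)-lipschitz_on {0..1} h \<and> h 0 = x \<and> h 1 = y" "C \<ge> 0"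
    and f: "K-lipschitz_on UNIV f" and \<tau>: "\<tau> > 0" "C * \<delta> \<le> K * \<tau>" and "\<delta> \<ge> 0" and "finite A"
    and near: "\<And>a. a \<in> A \<Longrightarrow> \<exists>t\<in>{0..S}. dist (f t) a \<le> \<delta>"
  shows "\<exists>g \<pi>. K-lipschitz_on UNIV g \<and> 1-lipschitz_on UNIV \<pi>
    \<and> (\<forall>s. 0 \<le> s - \<pi> s \<and> s - \<pi> s \<le> 2 * \<tau> * card A)
    \<and> (\<forall>s. dist (g s) (f (\<pi> s)) \<le> C * \<delta>)
    \<and> (\<forall>a\<in>A. \<exists>s\<in>{0..S + 2 * \<tau> * card A}. g s = a)
    \<and> (\<forall>u. \<exists>s. \<pi> s = u \<and> g s = f u)"
  using \<open>finite A\<close> near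
proof (induction A)
  case empty
  show ?case
    using f C(2) \<open>\<delta> \<ge> 0\<close> lipschitz_on_id[of "UNIV :: real set"]
    by (intro exI[of _ f] exI[of _ "\<lambda>s. s"]) simp
next
  case (insert a A)
  have near: "\<And>b. b \<in> A \<Longrightarrow> \<exists>t\<in>{0..S}. dist (f t) b \<le> \<delta>"
    using insert.prems by blast
  from near have "\<exists>g \<pi>. K-lipschitz_on UNIV g \<and> 1-lipschitz_on UNIV \<pi>
    \<and> (\<forall>s. 0 \<le> s - \<pi> s \<and> s - \<pi> s \<le> 2 * \<tau> * card A)
    \<and> (\<forall>s. dist (g s) (f (\<pi> s)) \<le> C * \<delta>)
    \<and> (\<forall>a\<in>A. \<exists>s\<in>{0..S + 2 * \<tau> * card A}. g s = a)
    \<and> (\<forall>u. \<exists>s. \<pi> s = u \<and> g s = f u)"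
    by (rule insert.IH)
  then obtain g \<pi> where g: "K-lipschitz_on UNIV g" and \<pi>: "1-lipschitz_on UNIV \<pi>"
    and delay: "\<And>s. 0 \<le> s - \<pi> s" "\<And>s. s - \<pi> s \<le> 2 * \<tau> * card A"
    and close: "\<And>s. dist (g s) (f (\<pi> s)) \<le> C * \<delta>"
    and hits: "\<And>a. a \<in> A \<Longrightarrow> \<exists>s\<in>{0..S + 2 * \<tau> * card A}. g s = a"
    and keep: "\<And>u. \<exists>s. \<pi> s = u \<and> g s = f u"
    by blast
  obtain t where t: "t \<in> {0..S}" "dist (f t) a \<le> \<delta>"
    using insert.prems by blast
  obtain r where r: "\<pi> r = t" "g r = f t"
    using keep by blast
  have rS: "r \<in> {0..S + 2 * \<tau> * card A}"
    using delay[of r] r t by auto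
  obtain h :: "real \<Rightarrow> 'a"
    where h: "(C * dist (f t) a)-lipschitz_on {0..1} h" "h 0 = f t" "h 1 = a"
    using C(1)[of "f t" a] by blast
  have "C * dist (f t) a \<le> K * \<tau>"
    using mult_left_mono[OF t(2) C(2)] \<tau>(2) by linarith
  then have "(K * \<tau>)-lipschitz_on {0..1} h" by (rule lipschitz_on_le[OF h(1)])
  then obtain g' \<pi>' where g': "K-lipschitz_on UNIV g'" and \<pi>': "1-lipschitz_on UNIV \<pi>'"
    and delay': "\<And>s. 0 \<le> s - \<pi>' s" "\<And>s. s - \<pi>' s \<le> 2 * \<tau>"
    and either: "\<And>s. g' s = g (\<pi>' s) \<or> \<pi>' s = r \<and> g' s \<in> h ` {0..1}"
    and hit: "g' (r + \<tau>) = h 1" and keep': "\<And>u. \<exists>s. \<pi>' s = u \<and> g' s = g u"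
    using insert_excursion[OF g \<tau>(1), of h r] h(2) r(2) by auto
  have card: "2 * \<tau> * card (insert a A) = 2 * \<tau> * card A + 2 * \<tau>"
    using insert.hyps by (simp add: algebra_simps)
  \<comment> \<open>The new excursion is inserted into \<open>g\<close>, so the collapse to the time scale of \<open>f\<close> is a composition.\<close>
  show ?case
  proof (intro exI[of _ g'] exI[of _ "\<lambda>s. \<pi> (\<pi>' s)"] conjI allI ballI g')
    show "1-lipschitz_on UNIV (\<lambda>s. \<pi> (\<pi>' s))"
      using lipschitz_on_compose2[OF \<pi>' lipschitz_on_subset[OF \<pi>]] by simp
    show "0 \<le> s - \<pi> (\<pi>' s)" "s - \<pi> (\<pi>' s) \<le> 2 * \<tau> * card (insert a A)" for s
      using delay[of "\<pi>' s"] delay'[of s] by (auto simp: card)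
    show "dist (g' s) (f (\<pi> (\<pi>' s))) \<le> C * \<delta>" for s
      using either[of s]
    proof
      assume "\<pi>' s = r \<and> g' s \<in> h ` {0..1}"
      then obtain v where v: "\<pi>' s = r" "g' s = h v" "v \<in> {0..1}" by blast
      have "dist (h v) (h 0) \<le> C * dist (f t) a * dist v 0"
        using v by (intro lipschitz_onD[OF h(1)]) auto
      also have "\<dots> \<le> C * dist (f t) a * 1"
        using v C(2) by (intro mult_left_mono) (auto simp: dist_real_def)
      also have "\<dots> \<le> C * \<delta>"
        using t(2) C(2) by (auto intro!: mult_left_mono)
      finally show ?thesis using v r h(2) by simp
    qed (use close in simp)
    show "\<exists>s\<in>{0..S + 2 * \<tau> * card (insert a A)}. g' s = b" if "b \<in> insert a A" for b
    proof (cases "b = a")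
      case True
      then show ?thesis
        using hit h(3) rS \<tau>(1) by (intro bexI[of _ "r + \<tau>"]) (auto simp: card)
    next
      case False
      then obtain u where u: "u \<in> {0..S + 2 * \<tau> * card A}" "g u = b"
        using \<open>b \<in> insert a A\<close> hits[of b] by auto
      obtain s where "\<pi>' s = u" "g' s = g u" using keep' by blast
      then show ?thesis
        using u delay'[of s] by (intro bexI[of _ s]) (auto simp: card)
    qed
    show "\<exists>s. \<pi> (\<pi>' s) = u \<and> g' s = f u" for u
    proof -
      obtain v where v: "\<pi> v = u" "g v = f u" using keep by blast
      obtain s where "\<pi>' s = v" "g' s = g v" using keep' by blast
      with v show ?thesis by auto
    qed
  qed
qed

section \<open>Inverse limits of collapsing maps\<close>

lemma summable_dist_imp_convergent:
  fixes x :: "nat \<Rightarrow> 'a::complete_space"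
  assumes step: "\<And>n. dist (x n) (x (Suc n)) \<le> e n" and e: "summable e"
  obtains l where "x \<longlonglongrightarrow> l" "\<And>n. dist (x n) l \<le> (\<Sum>i. e (i + n))"
proof -
  have e0: "0 \<le> e n" for n
    using step[of n] zero_le_dist order_trans by blast
  have sum: "dist (x n) (x (n + m)) \<le> (\<Sum>i<m. e (i + n))" for n m
  proof (induction m)
    case (Suc m)
    then show ?case
      using step[of "n + m"] dist_triangle[of "x n" "x (n + Suc m)" "x (n + m)"]
      by (simp add: add.commute)
  qed simp
  have tail: "dist (x n) (x m) \<le> (\<Sum>i. e (i + n))" if "n \<le> m" for n m
    using sum[of n "m - n"] that e e0
      sum_le_suminf[of "\<lambda>i. e (i + n)" "{..<m - n}"] by (fastforce simp: summable_iff_shift)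
  have "Cauchy x"
  proof (rule metric_CauchyI)
    fix r :: real assume "0 < r"
    then obtain N where N: "\<And>n. n \<ge> N \<Longrightarrow> norm (\<Sum>i. e (i + n)) < r / 2"
      using suminf_exist_split[of "r / 2" e] e by auto
    have "dist (x m) (x n) < r" if "m \<ge> N" "n \<ge> N" for m n
      using tail[OF that(1)] tail[OF that(2)] N[of N] dist_triangle2[of "x m" "x n" "x N"]
      by (simp add: dist_commute)
    then show "\<exists>M. \<forall>m\<ge>M. \<forall>n\<ge>M. dist (x m) (x n) < r" by blast
  qed
  then obtain l where l: "x \<longlonglongrightarrow> l"
    using Cauchy_convergent convergent_def by blast
  moreover have "dist (x n) l \<le> (\<Sum>i. e (i + n))" for n
    by (rule LIMSEQ_le_const2[OF tendsto_dist[OF tendsto_const l]]) (use tail in blast)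
  ultimately show thesis by (rule that)
qed

text \<open>\<open>P n\<close> is the limit of the compositions \<open>Q m n\<close> of \<open>\<pi> n\<close>, and so on up to \<open>\<pi> (n + m - 1)\<close>. Passing from \<open>m\<close> to
\<open>m + 1\<close> changes only the innermost argument, by at most \<open>\<Delta> (m + n)\<close>, and the 1-Lipschitz outer
maps do not enlarge this change.\<close>

lemma inverse_limit_of_collapses:
  fixes \<pi> :: "nat \<Rightarrow> real \<Rightarrow> real"
  assumes lip: "\<And>n. 1-lipschitz_on UNIV (\<pi> n)" and near: "\<And>n s. \<bar>\<pi> n s - s\<bar> \<le> \<Delta> n"
    and sum: "summable \<Delta>"
  obtains P where "\<And>n. 1-lipschitz_on UNIV (P n)" "\<And>n t. P n t = \<pi> n (P (Suc n) t)"
    "\<And>n t. \<bar>P n t - t\<bar> \<le> suminf \<Delta>"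
proof -
  define Q where "Q = rec_nat (\<lambda>n t. t) (\<lambda>m q n t. \<pi> n (q (Suc n) t))"
  have Q0: "Q 0 n t = t" and QS: "Q (Suc m) n t = \<pi> n (Q m (Suc n) t)" for m n t
    by (simp_all add: Q_def)
  have \<Delta>0: "0 \<le> \<Delta> n" for n
    using near[of n 0] by linarith
  have \<pi>: "\<bar>\<pi> n s - \<pi> n t\<bar> \<le> \<bar>s - t\<bar>" for n s t
    using lipschitz_onD[OF lip[of n], of s t] by (simp add: dist_real_def)
  have Qlip: "\<bar>Q m n s - Q m n t\<bar> \<le> \<bar>s - t\<bar>" for m n s t
  proof (induction m arbitrary: n)
    case (Suc m)
    show ?case using \<pi>[of n "Q m (Suc n) s" "Q m (Suc n) t"] Suc[of "Suc n"] by (simp add: QS)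
  qed (simp add: Q0)
  have step: "\<bar>Q m n t - Q (Suc m) n t\<bar> \<le> \<Delta> (m + n)" for m n t
  proof (induction m arbitrary: n)
    case 0
    show ?case using near[of n t] by (simp add: Q0 QS)
  next
    case (Suc m)
    have "\<bar>Q (Suc m) n t - Q (Suc (Suc m)) n t\<bar> \<le> \<bar>Q m (Suc n) t - Q (Suc m) (Suc n) t\<bar>"
      unfolding QS[of _ n] by (rule \<pi>)
    also have "\<dots> \<le> \<Delta> (Suc m + n)" using Suc.IH[of "Suc n"] by simp
    finally show ?case .
  qed
  have "\<exists>l. (\<lambda>m. Q m n t) \<longlonglongrightarrow> l \<and> \<bar>t - l\<bar> \<le> suminf \<Delta>" for n t
  proof -
    have "summable (\<lambda>m. \<Delta> (m + n))" using sum by (simp add: summable_iff_shift)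
    moreover have "dist (Q m n t) (Q (Suc m) n t) \<le> \<Delta> (m + n)" for m
      using step by (simp add: dist_real_def)
    ultimately obtain l where l: "(\<lambda>m. Q m n t) \<longlonglongrightarrow> l"
      "\<And>m. dist (Q m n t) l \<le> (\<Sum>i. \<Delta> (i + m + n))"
      using summable_dist_imp_convergent[of "\<lambda>m. Q m n t" "\<lambda>m. \<Delta> (m + n)"] by blast
    have "(\<Sum>i. \<Delta> (i + n)) \<le> suminf \<Delta>"
      using suminf_minus_initial_segment[OF sum, of n] \<Delta>0 by (simp add: sum_nonneg)
    then show ?thesis using l(2)[of 0] l(1) by (auto simp: Q0 dist_real_def)
  qed
  then obtain P where P: "\<And>n t. (\<lambda>m. Q m n t) \<longlonglongrightarrow> P n t" "\<And>n t. \<bar>t - P n t\<bar> \<le> suminf \<Delta>"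
    by metis
  show thesis
  proof
    show "1-lipschitz_on UNIV (P n)" for n
    proof (rule lipschitz_onI)
      fix s t
      have "(\<lambda>m. dist (Q m n s) (Q m n t)) \<longlonglongrightarrow> dist (P n s) (P n t)"
        by (intro tendsto_intros P)
      then have "dist (P n s) (P n t) \<le> dist s t"
        by (rule LIMSEQ_le_const2) (use Qlip in \<open>auto simp: dist_real_def\<close>)
      then show "dist (P n s) (P n t) \<le> 1 * dist s t" by simp
    qed simp
    show "P n t = \<pi> n (P (Suc n) t)" for n t
    proof -
      have "isCont (\<pi> n) (P (Suc n) t)"
        using lipschitz_on_continuous_within[OF lip[of n], of "P (Suc n) t"] by simp
      then have "(\<lambda>m. Q (Suc m) n t) \<longlonglongrightarrow> \<pi> n (P (Suc n) t)"
        unfolding QS using P(1) by (rule isCont_tendsto_compose)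
      then show ?thesis
        using LIMSEQ_Suc[OF P(1)[of n t]] LIMSEQ_unique by blast
    qed
    show "\<bar>P n t - t\<bar> \<le> suminf \<Delta>" for n t
      using P(2)[of t n] by (simp add: abs_minus_commute)
  qed
qed

lemma near_identity_surj:
  fixes P :: "real \<Rightarrow> real"
  assumes "continuous_on UNIV P" "\<And>t. \<bar>P t - t\<bar> \<le> B"
  shows "\<exists>t\<in>{u - B..u + B}. P t = u"
proof -
  have "0 \<le> B" using assms(2)[of 0] by linarith
  moreover have "P (u - B) \<le> u" "u \<le> P (u + B)"
    using assms(2)[of "u - B"] assms(2)[of "u + B"] by linarith+
  ultimately obtain t where "u - B \<le> t" "t \<le> u + B" "P t = u"
    using IVT'[of P "u - B" u "u + B"] continuous_on_subset[OF assms(1)] by auto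
  then show ?thesis by auto
qed

section \<open>Hoelder curves as limits of Lipschitz curves\<close>

lemma dyadic_scale:
  fixes x :: real
  assumes "0 < x" "x \<le> 1"
  obtains n :: nat where "x \<le> (1/2) ^ n" "(1/2) ^ n \<le> 2 * x"
proof -
  obtain m where m: "(1/2 :: real) ^ m < x"
    using real_arch_pow_inv[of x "1/2"] assms by auto
  define n where "n = (LEAST m. (1/2 :: real) ^ m < x)"
  have n: "(1/2) ^ n < x" unfolding n_def using m by (rule LeastI)
  with assms obtain k where k: "n = Suc k" by (cases n) auto
  have "\<not> (1/2) ^ k < x" using not_less_Least[of k "\<lambda>m. (1/2) ^ m < x"] k by (simp add: n_def)
  then show thesis using n k by (intro that[of k]) auto
qed

text \<open>To compare \<open>f s\<close> with \<open>f t\<close>, use the approximation \<open>G n\<close> with \<open>2\<^sup>-\<^sup>n\<close> comparable to \<open>\<rho>\<close> to the power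
\<open>1 / d\<close>, where \<open>\<rho> = \<bar>s - t\<bar>\<close>: then \<open>\<rho> \<le> 2\<^sup>-\<^sup>n\<^sup>d\<close>, and the Lipschitz bound for \<open>G n\<close> is of the same order
\<open>2\<^sup>-\<^sup>n\<close> as the error of the approximation.\<close>

lemma holder_curve_of_lipschitz_approximations:
  fixes f :: "real \<Rightarrow> 'a::metric_space"
  assumes d: "d \<ge> 1"
    and lip: "\<And>n. (K * 2 powr (real n * (d - 1)))-lipschitz_on {0..1} (G n)"
    and approx: "\<And>n u. u \<in> {0..1} \<Longrightarrow> dist (G n u) (f u) \<le> M * (1/2) ^ n"
  shows "holder_curve (1 / d) f"
proof -
  have K: "0 \<le> K" using lipschitz_on_nonneg[OF lip[of 0]] by simp
  have M: "0 \<le> M"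
    using order_trans[OF zero_le_dist approx[of 0 0]] by simp
  have "dist (f s) (f t) \<le> 2 * (K + 2 * M) * \<bar>s - t\<bar> powr (1 / d)"
    if st: "s \<in> {0..1}" "t \<in> {0..1}" for s t
  proof (cases "s = t")
    case False
    define \<rho> where "\<rho> = \<bar>s - t\<bar>"
    have \<rho>: "0 < \<rho>" "\<rho> \<le> 1" using False st by (auto simp: \<rho>_def)
    have "\<rho> powr (1 / d) \<le> 1"
      using \<rho> d by (intro powr_le1) auto
    with \<rho> obtain n where n: "\<rho> powr (1 / d) \<le> (1/2) ^ n" "(1/2) ^ n \<le> 2 * \<rho> powr (1 / d)"
      using dyadic_scale[of "\<rho> powr (1 / d)"] by auto
    have half: "(1/2 :: real) ^ n = 2 powr (- real n)"
      by (simp add: powr_minus_divide powr_realpow power_one_over)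
    have "\<rho> = (\<rho> powr (1 / d)) powr d"
      unfolding powr_powr using \<rho> d by simp
    also have "\<dots> \<le> (2 powr (- real n)) powr d"
      using n(1) d unfolding half by (intro powr_mono2) auto
    also have "\<dots> = 2 powr (- real n * d)" by (simp add: powr_powr)
    finally have \<rho>n: "\<rho> \<le> 2 powr (- real n * d)" .
    have "dist (f s) (f t) \<le> dist (G n s) (f s) + dist (G n s) (G n t) + dist (G n t) (f t)"
      using dist_triangle[of "f s" "f t" "G n s"] dist_triangle[of "G n s" "f t" "G n t"]
      by (simp add: dist_commute)
    also have "\<dots> \<le> M * (1/2) ^ n + K * 2 powr (real n * (d - 1)) * \<rho> + M * (1/2) ^ n"
      using lipschitz_onD[OF lip[of n] st] approx[of s n] approx[of t n] st
      by (simp add: \<rho>_def dist_real_def)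
    also have "K * 2 powr (real n * (d - 1)) * \<rho>
        \<le> K * 2 powr (real n * (d - 1)) * 2 powr (- real n * d)"
      using \<rho>n K by (intro mult_left_mono) auto
    also have "\<dots> = K * (1/2) ^ n"
      unfolding half by (simp add: algebra_simps flip: powr_add)
    also have "M * (1/2) ^ n + K * (1/2) ^ n + M * (1/2) ^ n = (K + 2 * M) * (1/2) ^ n"
      by (simp add: algebra_simps)
    also have "\<dots> \<le> (K + 2 * M) * (2 * \<rho> powr (1 / d))"
      using n(2) K M by (intro mult_left_mono) auto
    finally show ?thesis by (simp add: \<rho>_def algebra_simps)
  qed simp
  then show ?thesis
    unfolding holder_curve_def using d K M by (intro conjI exI[of _ "2 * (K + 2 * M)"]) auto
qed

lemma holder_curve_imp_continuous_on:
  assumes "holder_curve \<alpha> f"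
  shows "continuous_on {0..1} f"
proof -
  obtain L where \<alpha>: "0 < \<alpha>" and
    L: "\<And>s t. s \<in> {0..1} \<Longrightarrow> t \<in> {0..1} \<Longrightarrow> dist (f s) (f t) \<le> L * \<bar>s - t\<bar> powr \<alpha>"
    using assms unfolding holder_curve_def by blast
  show ?thesis
    unfolding continuous_on_def
  proof
    fix t :: real assume t: "t \<in> {0..1}"
    have "((\<lambda>s. L * \<bar>s - t\<bar> powr \<alpha>) \<longlongrightarrow> L * \<bar>t - t\<bar> powr \<alpha>) (at t within {0..1})"
      using \<alpha> by (intro tendsto_intros tendsto_powr') auto
    then have "((\<lambda>s. L * \<bar>s - t\<bar> powr \<alpha>) \<longlongrightarrow> 0) (at t within {0..1})" by simp
    then have "((\<lambda>s. dist (f s) (f t)) \<longlongrightarrow> 0) (at t within {0..1})"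
      by (rule tendsto_0_le[where K = 1])
        (use L t in \<open>auto simp: eventually_at_filter intro!: always_eventually order_trans[OF _ abs_ge_self]\<close>)
    then show "(f \<longlongrightarrow> f t) (at t within {0..1})"
      by (subst tendsto_dist_iff)
  qed
qed

section \<open>The tower of excursions and its limit\<close>

text \<open>\<open>F 0\<close> rests at the root \<open>r\<close>, and \<open>F (Suc n)\<close> makes excursions from \<open>F n\<close> to all points of \<open>A n\<close>,
each of them taking the time \<open>2\<^sup>-\<^sup>n\<^sup>d\<close> in each direction. With \<open>D 2\<^sup>-\<^sup>n\<close> as the distance of \<open>A n\<close> from
\<open>F n\<close>, the speed \<open>C D 2\<^sup>-\<^sup>n / 2\<^sup>-\<^sup>n\<^sup>d\<close> on these excursions is exactly the stated Lipschitz constant.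
\<open>\<Delta> n\<close> is the time that stage \<open>n\<close> inserts, so the visits to \<open>A n\<close> take place no later than at
time \<open>\<Delta> 0 + \<dots> + \<Delta> n\<close>.\<close>

lemma tower_of_excursions:
  fixes A :: "nat \<Rightarrow> 'a::metric_space set" and r :: 'a and d :: real
  assumes C: "\<And>x y::'a. \<exists>h::real \<Rightarrow> 'a. (C * dist x y)-lipschitz_on {0..1} h \<and> h 0 = x \<and> h 1 = y" "C \<ge> 0"
    and d: "d \<ge> 1" and D: "D \<ge> 0" and fin: "\<And>n. finite (A n)"
    and root: "\<And>a. a \<in> A 0 \<Longrightarrow> dist r a \<le> D"
    and parent: "\<And>n a. a \<in> A (Suc n) \<Longrightarrow> \<exists>b\<in>A n. dist b a \<le> D * (1/2) ^ Suc n"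
  defines "\<Delta> \<equiv> \<lambda>n. 2 * 2 powr (- (real n * d)) * card (A n)"
  obtains F \<pi> where
    "\<And>n. (C * D * 2 powr (real n * (d - 1)))-lipschitz_on UNIV (F n)"
    "\<And>n. 1-lipschitz_on UNIV (\<pi> n)" "\<And>n s. \<bar>\<pi> n s - s\<bar> \<le> \<Delta> n"
    "\<And>n s. dist (F n (\<pi> n s)) (F (Suc n) s) \<le> C * D * (1/2) ^ n"
    "\<And>n a. a \<in> A n \<Longrightarrow> \<exists>s\<in>{0..\<Sum>i<Suc n. \<Delta> i}. F (Suc n) s = a"
proof -
  define K where "K = (\<lambda>n. C * D * 2 powr (real n * (d - 1)))"
  define T where "T = (\<lambda>n. \<Sum>i<n. \<Delta> i)"
  define P where "P = (\<lambda>n F. (K n)-lipschitz_on UNIV F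
    \<and> (\<forall>a\<in>A n. \<exists>t\<in>{0..T n}. dist (F t) a \<le> D * (1/2) ^ n))"
  define R where "R = (\<lambda>n F G. \<exists>\<pi>. 1-lipschitz_on UNIV \<pi> \<and> (\<forall>s. \<bar>\<pi> s - s\<bar> \<le> \<Delta> n)
    \<and> (\<forall>s. dist (F (\<pi> s)) (G s) \<le> C * D * (1/2) ^ n) \<and> (\<forall>a\<in>A n. \<exists>s\<in>{0..T (Suc n)}. G s = a))"
  have "\<exists>F. \<forall>n. P n (F n) \<and> R n (F n) (F (Suc n))"
  proof (rule dependent_nat_choice)
    have "(K 0)-lipschitz_on UNIV (\<lambda>_::real. r)"
      using C(2) D by (intro lipschitz_onI) (auto simp: K_def)
    then show "\<exists>F. P 0 F"
      using root by (intro exI[of _ "\<lambda>_. r"]) (simp add: P_def T_def)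
  next
    fix F n assume F: "P n F"
    have half: "(1/2 :: real) ^ n = 2 powr (- real n)"
      by (simp add: powr_minus_divide powr_realpow power_one_over)
    have "K n * 2 powr (- (real n * d)) = C * (D * (1/2) ^ n)"
      unfolding half K_def by (simp add: algebra_simps flip: powr_add)
    then obtain G \<pi> where G: "(K n)-lipschitz_on UNIV G" and \<pi>: "1-lipschitz_on UNIV \<pi>"
      and delay: "\<forall>s. 0 \<le> s - \<pi> s \<and> s - \<pi> s \<le> 2 * 2 powr (- (real n * d)) * card (A n)"
      and close: "\<forall>s. dist (G s) (F (\<pi> s)) \<le> C * (D * (1/2) ^ n)"
      and hits: "\<forall>a\<in>A n. \<exists>s\<in>{0..T n + 2 * 2 powr (- (real n * d)) * card (A n)}. G s = a"
      using insert_excursions[OF C, of "K n" F "2 powr (- (real n * d))" "D * (1/2) ^ n" "A n" "T n"]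
        F D fin[of n] unfolding P_def by (simp, blast)
    have T: "T (Suc n) = T n + 2 * 2 powr (- (real n * d)) * card (A n)"
      by (simp add: T_def \<Delta>_def)
    have hits': "\<forall>a\<in>A n. \<exists>s\<in>{0..T (Suc n)}. G s = a"
      using hits unfolding T .
    have "K n \<le> K (Suc n)"
      unfolding K_def using C(2) D d by (intro mult_left_mono powr_mono mult_right_mono) auto
    then have "(K (Suc n))-lipschitz_on UNIV G" by (rule lipschitz_on_le[OF G])
    moreover have "\<exists>t\<in>{0..T (Suc n)}. dist (G t) a \<le> D * (1/2) ^ Suc n" if "a \<in> A (Suc n)" for a
      using parent[OF that] hits' by metis
    moreover have "R n F G"
      unfolding R_def
    proof (intro exI[of _ \<pi>] conjI allI \<pi> hits')
      show "\<bar>\<pi> s - s\<bar> \<le> \<Delta> n" for s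
        using spec[OF delay, of s] by (simp add: \<Delta>_def)
      show "dist (F (\<pi> s)) (G s) \<le> C * D * (1/2) ^ n" for s
        using spec[OF close, of s] by (simp add: dist_commute mult.assoc)
    qed
    ultimately show "\<exists>G. P (Suc n) G \<and> R n F G"
      unfolding P_def by blast
  qed
  then obtain F where F: "\<And>n. P n (F n)" "\<And>n. R n (F n) (F (Suc n))" by blast
  from F(2) obtain \<pi> where "\<And>n. 1-lipschitz_on UNIV (\<pi> n) \<and> (\<forall>s. \<bar>\<pi> n s - s\<bar> \<le> \<Delta> n)
    \<and> (\<forall>s. dist (F n (\<pi> n s)) (F (Suc n) s) \<le> C * D * (1/2) ^ n)
    \<and> (\<forall>a\<in>A n. \<exists>s\<in>{0..T (Suc n)}. F (Suc n) s = a)"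
    unfolding R_def by metis
  with F(1) show thesis
    unfolding P_def K_def T_def by (intro that[of F \<pi>]) blast+
qed

text \<open>Since \<open>P n = \<pi> n \<circ> P (n + 1)\<close>, the curves \<open>F n \<circ> P n\<close> satisfy \<open>dist (F n (P n t)) (F (n + 1) (P (n + 1) t))
\<le> M 2\<^sup>-\<^sup>n\<close> for all \<open>t\<close> and converge uniformly, with an error of at most \<open>2 M 2\<^sup>-\<^sup>n\<close>. A visit of \<open>F (n + 1)\<close>
to a point \<open>a\<close> becomes an approach of the limit to \<open>a\<close>, because \<open>P (n + 1)\<close> is onto.\<close>

lemma holder_curve_limit_of_tower:
  fixes F :: "nat \<Rightarrow> real \<Rightarrow> 'a::complete_space" and A :: "nat \<Rightarrow> 'a set"
  assumes d: "d \<ge> 1"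
    and F: "\<And>n. (K * 2 powr (real n * (d - 1)))-lipschitz_on UNIV (F n)"
    and \<pi>: "\<And>n. 1-lipschitz_on UNIV (\<pi> n)" "\<And>n s. \<bar>\<pi> n s - s\<bar> \<le> \<Delta> n" "summable \<Delta>"
    and close: "\<And>n s. dist (F n (\<pi> n s)) (F (Suc n) s) \<le> M * (1/2) ^ n"
    and hits: "\<And>n a. a \<in> A n \<Longrightarrow> \<exists>s\<in>{0..\<Sum>i<Suc n. \<Delta> i}. F (Suc n) s = a"
  obtains f where "holder_curve (1 / d) f"
    "\<And>n a. a \<in> A n \<Longrightarrow> \<exists>u\<in>{0..1}. dist (f u) a \<le> M * (1/2) ^ n"
proof -
  obtain P where P: "\<And>n. 1-lipschitz_on UNIV (P n)" "\<And>n t. P n t = \<pi> n (P (Suc n) t)"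
    "\<And>n t. \<bar>P n t - t\<bar> \<le> suminf \<Delta>"
    using inverse_limit_of_collapses[OF \<pi>] by blast
  define S where "S = suminf \<Delta>"
  have \<Delta>0: "0 \<le> \<Delta> n" for n
    using \<pi>(2)[of n 0] by linarith
  have S: "0 \<le> S" "(\<Sum>i<n. \<Delta> i) \<le> S" for n
    unfolding S_def using \<Delta>0 \<pi>(3) by (auto intro: suminf_nonneg sum_le_suminf)
  have tail: "(\<Sum>i. M * (1/2) ^ (i + n)) = 2 * M * (1/2 :: real) ^ n" for n
  proof -
    have "(\<lambda>i. M * (1/2) ^ n * (1/2 :: real) ^ i) sums (M * (1/2) ^ n * (1 / (1 - 1/2)))"
      by (intro sums_mult geometric_sums) simp
    then show ?thesis
      by (intro sums_unique[symmetric]) (simp add: power_add mult_ac)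
  qed
  have "\<exists>l. \<forall>n. dist (F n (P n t)) l \<le> 2 * M * (1/2) ^ n" for t
  proof -
    have "dist (F n (P n t)) (F (Suc n) (P (Suc n) t)) \<le> M * (1/2) ^ n" for n
      unfolding P(2)[of n] by (rule close)
    moreover have "summable (\<lambda>n. M * (1/2 :: real) ^ n)"
      by (intro summable_mult summable_geometric) simp
    ultimately obtain l where "\<And>n. dist (F n (P n t)) l \<le> (\<Sum>i. M * (1/2) ^ (i + n))"
      using summable_dist_imp_convergent[of "\<lambda>n. F n (P n t)" "\<lambda>n. M * (1/2) ^ n"] by blast
    then show ?thesis unfolding tail by blast
  qed
  then obtain g where g: "\<And>t n. dist (F n (P n t)) (g t) \<le> 2 * M * (1/2) ^ n" by metis
  \<comment> \<open>All visits take place at times \<open>s\<close> from 0 to \<open>S\<close>, and \<open>P n\<close> moves points by at most \<open>S\<close>; so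
    the part of the limit curve from \<open>- S\<close> to \<open>2 * S\<close> suffices. The summand 1 makes \<open>B\<close> positive.\<close>
  define B where "B = 3 * S + 1"
  have B: "0 < B" using S by (simp add: B_def)
  define f where "f = (\<lambda>u. g (B * u - S))"
  show thesis
  proof
    show "holder_curve (1 / d) f"
    proof (rule holder_curve_of_lipschitz_approximations[OF d])
      fix n
      have K: "0 \<le> K" using lipschitz_on_nonneg[OF F[of 0]] by simp
      show "(K * B * 2 powr (real n * (d - 1)))-lipschitz_on {0..1} (\<lambda>u. F n (P n (B * u - S)))"
      proof (rule lipschitz_onI)
        fix u v :: real
        have "dist (F n (P n (B * u - S))) (F n (P n (B * v - S)))
            \<le> K * 2 powr (real n * (d - 1)) * dist (P n (B * u - S)) (P n (B * v - S))"
          by (intro lipschitz_onD[OF F]) auto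
        also have "\<dots> \<le> K * 2 powr (real n * (d - 1)) * (1 * dist (B * u - S) (B * v - S))"
          using K by (intro mult_left_mono lipschitz_onD[OF P(1)]) auto
        also have "dist (B * u - S) (B * v - S) = B * dist u v"
          using B by (simp add: dist_real_def abs_mult flip: right_diff_distrib)
        finally show "dist (F n (P n (B * u - S))) (F n (P n (B * v - S)))
            \<le> K * B * 2 powr (real n * (d - 1)) * dist u v"
          by (simp add: mult_ac)
      qed (use K B in simp)
      show "dist (F n (P n (B * u - S))) (f u) \<le> 2 * M * (1/2) ^ n" for u
        unfolding f_def by (rule g)
    qed
    fix n a assume "a \<in> A n"
    then obtain s where s: "0 \<le> s" "s \<le> S" "F (Suc n) s = a"
      using hits[of a n] S(2)[of "Suc n"] by force
    have "continuous_on UNIV (P (Suc n))"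
      using P(1) by (rule lipschitz_on_continuous_on)
    then obtain t where t: "t \<in> {s - S..s + S}" "P (Suc n) t = s"
      using near_identity_surj[of "P (Suc n)" S s] P(3) unfolding S_def by blast
    show "\<exists>u\<in>{0..1}. dist (f u) a \<le> M * (1/2) ^ n"
    proof (rule bexI[of _ "(t + S) / B"])
      show "(t + S) / B \<in> {0..1}"
        using t(1) s B by (auto simp: B_def field_simps)
      show "dist (f ((t + S) / B)) a \<le> M * (1/2) ^ n"
        using g[of "Suc n" t] t(2) s(3) B by (simp add: f_def dist_commute)
    qed
  qed
qed

section \<open>Nets of minimal cardinality\<close>

lemma covering_number_attained:
  assumes "covering_number S \<epsilon> \<noteq> \<infinity>"
  obtains A where "finite A" "S \<subseteq> (\<Union>a\<in>A. ball a \<epsilon>)" "covering_number S \<epsilon> = enat (card A)"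
proof -
  define I where "I = {A. finite A \<and> S \<subseteq> (\<Union>a\<in>A. ball a \<epsilon>)}"
  have "I \<noteq> {}"
    using assms unfolding covering_number_def I_def[symmetric] by (auto simp: top_enat_def)
  then have "(INF A\<in>I. enat (card A)) \<in> (\<lambda>A. enat (card A)) ` I"
    by (auto intro: wellorder_InfI)
  then show thesis
    using that unfolding covering_number_def I_def by blast
qed

text \<open>The minimal covers are finite because all terms of a convergent sum are finite and the weights
do not vanish. Discarding the balls that miss \<open>Y\<close> is harmless for the sum and ties each net to \<open>Y\<close>,
and thereby consecutive nets to each other.\<close>

lemma nets_of_covering_sum:
  fixes Y :: "'a::metric_space set"
  assumes sum: "(\<Sum>k. ennreal_of_enat (covering_number Y (\<epsilon>0 * 2 powr (- real k)))
                       * ennreal (2 powr (- (real k * d)))) < \<infinity>"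
  obtains A where "\<And>k. finite (A k)" "\<And>k. Y \<subseteq> (\<Union>a\<in>A k. ball a (\<epsilon>0 * (1/2) ^ k))"
    "\<And>k a. a \<in> A k \<Longrightarrow> \<exists>y\<in>Y. dist a y < \<epsilon>0 * (1/2) ^ k"
    "summable (\<lambda>k. card (A k) * 2 powr (- (real k * d)))"
proof -
  have half: "2 powr (- real k) = (1/2 :: real) ^ k" for k
    by (simp add: powr_minus_divide powr_realpow power_one_over)
  define N where "N = (\<lambda>k. covering_number Y (\<epsilon>0 * (1/2) ^ k))"
  define w where "w = (\<lambda>k. 2 powr (- (real k * d)))"
  have sum': "(\<Sum>k. ennreal_of_enat (N k) * ennreal (w k)) < \<infinity>"
    using sum by (simp add: N_def w_def half)
  have "N k \<noteq> \<infinity>" for k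
  proof
    assume "N k = \<infinity>"
    then have "ennreal_of_enat (N k) * ennreal (w k) = \<infinity>"
      by (simp add: w_def ennreal_top_mult)
    then have "\<infinity> \<le> (\<Sum>k. ennreal_of_enat (N k) * ennreal (w k))"
      using sum_le_suminf[of "\<lambda>k. ennreal_of_enat (N k) * ennreal (w k)" "{k}"] by simp
    with sum' show False by simp
  qed
  then have "\<exists>A. finite A \<and> Y \<subseteq> (\<Union>a\<in>A. ball a (\<epsilon>0 * (1/2) ^ k)) \<and> N k = enat (card A)" for k
    using covering_number_attained unfolding N_def by metis
  then obtain B where B: "\<And>k. finite (B k)" "\<And>k. Y \<subseteq> (\<Union>a\<in>B k. ball a (\<epsilon>0 * (1/2) ^ k))"
    "\<And>k. N k = enat (card (B k))" by metis
  define A where "A = (\<lambda>k. {a \<in> B k. \<exists>y\<in>Y. dist a y < \<epsilon>0 * (1/2) ^ k})"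
  have "(\<Sum>k. ennreal (card (B k) * w k)) < \<infinity>"
    using sum' by (simp add: B(3) ennreal_mult w_def ennreal_of_nat_eq_real_of_nat)
  then have sB: "summable (\<lambda>k. card (B k) * w k)"
    by (intro summable_suminf_not_top) (auto simp: w_def)
  show thesis
  proof
    show "finite (A k)" for k using B(1)[of k] by (simp add: A_def)
    show "Y \<subseteq> (\<Union>a\<in>A k. ball a (\<epsilon>0 * (1/2) ^ k))" for k
      using B(2)[of k] by (fastforce simp: A_def)
    show "\<exists>y\<in>Y. dist a y < \<epsilon>0 * (1/2) ^ k" if "a \<in> A k" for k a
      using that by (simp add: A_def)
    have "card (A k) \<le> card (B k)" for k
      by (rule card_mono[OF B(1)]) (auto simp: A_def)
    then show "summable (\<lambda>k. card (A k) * 2 powr (- (real k * d)))"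
      unfolding w_def[symmetric]
      by (intro summable_comparison_test'[OF sB, of 0]) (auto simp: w_def intro!: mult_right_mono)
  qed
qed

section \<open>Covering a set by a Hoelder curve\<close>

theorem theorem1p2:
  fixes Y :: "'a::complete_space set" and d :: real
  assumes "quasiconvex (UNIV :: 'a set)"
    and "d \<ge> 1"
    and "\<exists>\<epsilon>\<^sub>0>0. (\<Sum>k. ennreal_of_enat (covering_number Y (\<epsilon>\<^sub>0 * 2 powr (- real k)))
                       * ennreal (2 powr (- (real k * d)))) < \<infinity>"
  shows "\<exists>f :: real \<Rightarrow> 'a. holder_curve (1 / d) f \<and> Y \<subseteq> f ` {0..1}"
proof -
  obtain \<epsilon> where \<epsilon>: "\<epsilon> > 0" and sum: "(\<Sum>k. ennreal_of_enat (covering_number Y (\<epsilon> * 2 powr (- real k)))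
                       * ennreal (2 powr (- (real k * d)))) < \<infinity>"
    using assms(3) by blast
  obtain A where A: "\<And>k. finite (A k)" "\<And>k. Y \<subseteq> (\<Union>a\<in>A k. ball a (\<epsilon> * (1/2) ^ k))"
    "\<And>k a. a \<in> A k \<Longrightarrow> \<exists>y\<in>Y. dist a y < \<epsilon> * (1/2) ^ k"
    "summable (\<lambda>k. card (A k) * 2 powr (- (real k * d)))"
    using nets_of_covering_sum[OF sum] by blast
  obtain C where C: "C \<ge> 1" and
    conn: "\<And>x y::'a. \<exists>h::real \<Rightarrow> 'a. (C * dist x y)-lipschitz_on {0..1} h \<and> h 0 = x \<and> h 1 = y"
    using quasiconvex_imp_lipschitz_connected[OF assms(1)] by blast
  obtain r :: 'a where True by simp
  \<comment> \<open>Two balls of radii \<open>\<epsilon> 2\<^sup>-\<^sup>n\<close> and \<open>\<epsilon> 2\<^sup>-\<^sup>n\<^sup>-\<^sup>1\<close> with a common point have centres at distance less than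
    \<open>3 \<epsilon> 2\<^sup>-\<^sup>n\<^sup>-\<^sup>1\<close>; the sum is there for the distances of the points of \<open>A 0\<close> from the arbitrary root.\<close>
  define D where "D = 3 * \<epsilon> + (\<Sum>a\<in>A 0. dist r a)"
  have D: "3 * \<epsilon> \<le> D" by (simp add: D_def sum_nonneg)
  have root: "dist r a \<le> D" if "a \<in> A 0" for a
    using member_le_sum[OF that, of "dist r"] A(1)[of 0] \<epsilon> by (simp add: D_def)
  have parent: "\<exists>b\<in>A n. dist b a \<le> D * (1/2) ^ Suc n" if a: "a \<in> A (Suc n)" for n a
  proof -
    obtain y where y: "y \<in> Y" "dist a y < \<epsilon> * (1/2) ^ Suc n" using A(3)[OF a] by blast
    obtain b where b: "b \<in> A n" "dist b y < \<epsilon> * (1/2) ^ n" using A(2)[of n] y(1) by auto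
    have "dist b a \<le> 3 * \<epsilon> * (1/2) ^ Suc n"
      using dist_triangle2[of b a y] y(2) b(2) by simp
    also have "\<dots> \<le> D * (1/2) ^ Suc n"
      using D by (intro mult_right_mono) auto
    finally show ?thesis using b(1) by blast
  qed
  define \<Delta> where "\<Delta> = (\<lambda>n. 2 * 2 powr (- (real n * d)) * card (A n))"
  obtain F \<pi> where F: "\<And>n. (C * D * 2 powr (real n * (d - 1)))-lipschitz_on UNIV (F n)"
    "\<And>n. 1-lipschitz_on UNIV (\<pi> n)" "\<And>n s. \<bar>\<pi> n s - s\<bar> \<le> \<Delta> n"
    "\<And>n s. dist (F n (\<pi> n s)) (F (Suc n) s) \<le> C * D * (1/2) ^ n"
    "\<And>n a. a \<in> A n \<Longrightarrow> \<exists>s\<in>{0..\<Sum>i<Suc n. \<Delta> i}. F (Suc n) s = a"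
    using tower_of_excursions[of C d D A r] conn C assms(2) D \<epsilon> A(1) root parent
    unfolding \<Delta>_def by auto
  have "summable \<Delta>"
    unfolding \<Delta>_def using summable_mult[OF A(4), of 2] by (simp add: mult_ac)
  then obtain f where f: "holder_curve (1 / d) f"
    "\<And>n a. a \<in> A n \<Longrightarrow> \<exists>u\<in>{0..1}. dist (f u) a \<le> C * D * (1/2) ^ n"
    using holder_curve_limit_of_tower[OF assms(2) F(1-3) _ F(4,5)] by blast
  have "continuous_on {0..1} f"
    using f(1) by (rule holder_curve_imp_continuous_on)
  then have closed: "closed (f ` {0..1})"
    by (intro compact_imp_closed compact_continuous_image) auto
  have "y \<in> f ` {0..1}" if y: "y \<in> Y" for y
  proof -
    have near: "\<exists>u\<in>{0..1}. dist (f u) y \<le> (C * D + \<epsilon>) * (1/2) ^ n" for n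
    proof -
      obtain a where a: "a \<in> A n" "dist a y < \<epsilon> * (1/2) ^ n" using A(2)[of n] y by auto
      obtain u where u: "u \<in> {0..1}" "dist (f u) a \<le> C * D * (1/2) ^ n" using f(2)[OF a(1)] by blast
      show ?thesis
        using dist_triangle[of "f u" y a] a(2) u by (intro bexI[of _ u]) (auto simp: algebra_simps)
    qed
    have "y \<in> closure (f ` {0..1})"
      unfolding closure_approachable
    proof (intro allI impI)
      fix e :: real assume "0 < e"
      have "(\<lambda>n. (C * D + \<epsilon>) * (1/2) ^ n) \<longlonglongrightarrow> (C * D + \<epsilon>) * 0"
        by (intro tendsto_mult tendsto_const LIMSEQ_realpow_zero) auto
      then have "eventually (\<lambda>n. (C * D + \<epsilon>) * (1/2) ^ n < e) sequentially"
        using \<open>0 < e\<close> by (intro order_tendstoD) auto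
      then obtain n where "(C * D + \<epsilon>) * (1/2) ^ n < e"
        by (auto simp: eventually_sequentially)
      then show "\<exists>x\<in>f ` {0..1}. dist x y < e"
        using near[of n] by force
    qed
    then show ?thesis using closed by simp
  qed
  with f(1) show ?thesis by blast
qed

end
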